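(* Let $n\ge 1$ and $d\ge 1$ be integers, and let $S\subset [n]^\infty$ be a $d$-maximal set that contains no $1$-ball. Then \[ |S|\le d^2\,(n+8n^{2/3})^d . \]
   Context: $[n]=\{1,2,\dots,n\}$ and $[n]^\infty$ is the set of infinite sequences $a=(a_1,a_2,\dots)$ with $a_i\in[n]$. The Hamming distance is $\mathrm{dist}(a,b)=|\{i: a_i\ne b_i\}|$ (possibly infinite). For $S\subset[n]^\infty$, $\mathrm{diam}(S)=\sup_{a,b\in S}\mathrm{dist}(a,b)$. A set $S\subset[n]^\infty$ is $d$-maximal if $\mathrm{diam}(S)=d$ and $S$ is inclusion-maximal among subsets of $[n]^\infty$ of diameter $d$ (i.e. adding any point of $[n]^\infty\setminus S$ increases the diameter). For $a\in[n]^\infty$ and integer $\ell\ge0$, $\mathrm{Ball}(a,\ell)=\{b\in[n]^\infty:\mathrm{dist}(a,b)\le \ell\}$; an $\ell$-ball is a set of the form $\mathrm{Ball}(a,\ell)$, and $S$ contains an $\ell$-ball if $\mathrm{Ball}(a,\ell)\subset S$ for some $a$. *)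

theory Defs
  imports Complex_Main "HOL-Library.FuncSet" "HOL-Library.Extended_Nat"
begin

text \<open>Positions of a sequence are numbered from 0 instead of from 1.\<close>

definition seqs :: "nat \<Rightarrow> (nat \<Rightarrow> nat) set" where
  "seqs n = (UNIV \<rightarrow> {1..n})"

definition hamming_dist :: "(nat \<Rightarrow> nat) \<Rightarrow> (nat \<Rightarrow> nat) \<Rightarrow> enat" where
  "hamming_dist a b =
     (if finite {i. a i \<noteq> b i} then enat (card {i. a i \<noteq> b i}) else \<infinity>)"

definition hamming_diam :: "(nat \<Rightarrow> nat) set \<Rightarrow> enat" where
  "hamming_diam S = (SUP a\<in>S. SUP b\<in>S. hamming_dist a b)"

definition diam_maximal :: "nat \<Rightarrow> nat \<Rightarrow> (nat \<Rightarrow> nat) set \<Rightarrow> bool" where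
  "diam_maximal n d S \<longleftrightarrow>
     S \<subseteq> seqs n \<and> hamming_diam S = enat d \<and>
     (\<forall>T. S \<subseteq> T \<and> T \<subseteq> seqs n \<and> hamming_diam T = enat d \<longrightarrow> T = S)"

definition hamming_ball :: "nat \<Rightarrow> (nat \<Rightarrow> nat) \<Rightarrow> nat \<Rightarrow> (nat \<Rightarrow> nat) set" where
  "hamming_ball n a l = {b \<in> seqs n. hamming_dist a b \<le> enat l}"

definition contains_ball :: "nat \<Rightarrow> nat \<Rightarrow> (nat \<Rightarrow> nat) set \<Rightarrow> bool" where
  "contains_ball n l S \<longleftrightarrow> (\<exists>a\<in>seqs n. hamming_ball n a l \<subseteq> S)"

end

theory Submission
  imports Defs
begin

text \<open>
  Fix \<open>z, w \<in> S\<close> at distance exactly \<open>d\<close>; they exist because \<open>S\<close> contains no 1-ball. Reveal an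
  unknown \<open>a \<in> S\<close> on the \<open>d\<close> coordinates where \<open>z\<close> and \<open>w\<close> differ. If \<open>a\<close> still differs from \<open>z\<close>
  in \<open>v\<close> other places, then on the revealed coordinates it agrees with each of \<open>z\<close> and \<open>w\<close> at
  least \<open>v\<close> times, which leaves at most \<open>(d choose v) (d - v choose v) n\<^sup>d\<^sup>-\<^sup>2\<^sup>v\<close> possibilities.

  Given what is revealed, complete it by \<open>z\<close> to a guess \<open>a'\<close>. Maximality (if \<open>a' \<notin> S\<close>) or the
  absence of 1-balls (if \<open>a' \<in> S\<close>) gives \<open>c \<in> S\<close> at distance at least \<open>d\<close> from \<open>a'\<close>. Reveal \<open>a\<close>
  on the coordinates where \<open>c\<close> differs from \<open>z\<close>, of which at most \<open>d/2\<close> are new. As \<open>a\<close> is within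
  \<open>d\<close> of \<open>c\<close>, the number of differences from \<open>z\<close> that remain hidden is at most the number of new
  agreements with \<open>c\<close>, so it at least halves. By induction at most \<open>(d choose v) (3n)\<^sup>v\<close> points are
  compatible with \<open>v\<close> hidden differences. Summing over \<open>v\<close> with weights \<open>t\<^sup>3\<^sup>v\<close>, \<open>t\<^sup>3 \<ge> 3/n\<close>, yields
  \<open>n\<^sup>d (1 + t)\<^sup>d (1 + 2t)\<^sup>d\<close>, and \<open>t\<close> of order \<open>n\<^sup>-\<^sup>1\<^sup>/\<^sup>3\<close> is where the exponent \<open>2/3\<close> comes from.
\<close>

section \<open>Counting by fibres and by prescribed agreements\<close>

lemma finite_card_le_fibres:
  assumes "finite Q" and "\<And>a. a \<in> A \<Longrightarrow> f a \<in> Q"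
    and fib: "\<And>q. q \<in> Q \<Longrightarrow> finite {a \<in> A. f a = q} \<and> card {a \<in> A. f a = q} \<le> M"
  shows "finite A \<and> card A \<le> card Q * M"
proof -
  have A: "A = (\<Union>q\<in>Q. {a \<in> A. f a = q})"
    using assms(2) by auto
  have fin: "finite (\<Union>q\<in>Q. {a \<in> A. f a = q})"
    using assms(1) fib by blast
  have "card (\<Union>q\<in>Q. {a \<in> A. f a = q}) \<le> (\<Sum>q\<in>Q. card {a \<in> A. f a = q})"
    by (rule card_UN_le[OF assms(1)])
  also have "\<dots> \<le> (\<Sum>q\<in>Q. M)"
    by (rule sum_mono) (use fib in blast)
  finally show ?thesis
    using A fin by simp
qed

text \<open>Union bound over pairs \<open>(V, W)\<close> of agreement sets with \<open>c\<close> and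
  with \<open>z\<close>. They are disjoint because \<open>c\<close> and \<open>z\<close> differ
  throughout \<open>Y\<close>; on the rest of \<open>Y\<close> the values are free.\<close>

lemma card_agreeing_functions:
  fixes c z :: "'i \<Rightarrow> 'b" and \<alpha> \<beta> :: nat
  assumes "finite Y" and "finite B" and ne: "\<And>i. i \<in> Y \<Longrightarrow> c i \<noteq> z i"
  defines "Q \<equiv> {q \<in> Y \<rightarrow>\<^sub>E B. \<alpha> \<le> card {i \<in> Y. q i = c i} \<and> \<beta> \<le> card {i \<in> Y. q i = z i}}"
  shows "finite Q \<and> card Q \<le> (card Y choose \<alpha>) * ((card Y - \<alpha>) choose \<beta>) * card B ^ (card Y - \<alpha> - \<beta>)"
proof -
  define I where "I = (SIGMA V : {V. V \<subseteq> Y \<and> card V = \<alpha>}. {W. W \<subseteq> Y - V \<and> card W = \<beta>})"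
  define G where "G = (\<lambda>(V, W). {q \<in> Y \<rightarrow>\<^sub>E B. (\<forall>i\<in>V. q i = c i) \<and> (\<forall>i\<in>W. q i = z i)})"
  have finQ: "finite Q"
    unfolding Q_def using assms(1,2) by (simp add: finite_PiE)
  have finI: "finite I"
    unfolding I_def using assms(1) by auto
  have "card I = (\<Sum>V\<in>{V. V \<subseteq> Y \<and> card V = \<alpha>}. card {W. W \<subseteq> Y - V \<and> card W = \<beta>})"
    unfolding I_def using assms(1) by (subst card_SigmaI) auto
  also have "\<dots> = (\<Sum>V\<in>{V. V \<subseteq> Y \<and> card V = \<alpha>}. (card Y - \<alpha>) choose \<beta>)"
    using assms(1) by (intro sum.cong refl)
      (auto simp: n_subsets card_Diff_subset finite_subset)
  finally have cardI: "card I = (card Y choose \<alpha>) * ((card Y - \<alpha>) choose \<beta>)"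
    using assms(1) by (simp add: n_subsets)
  have "Q \<subseteq> (\<Union>p\<in>I. G p)"
  proof
    fix q assume q: "q \<in> Q"
    obtain V where V: "V \<subseteq> {i \<in> Y. q i = c i}" "card V = \<alpha>"
      using q unfolding Q_def by (metis (no_types, lifting) mem_Collect_eq obtain_subset_with_card_n)
    obtain W where W: "W \<subseteq> {i \<in> Y. q i = z i}" "card W = \<beta>"
      using q unfolding Q_def by (metis (no_types, lifting) mem_Collect_eq obtain_subset_with_card_n)
    have "W \<subseteq> Y - V"
      using V W ne by fastforce
    then have "(V, W) \<in> I"
      unfolding I_def using V W by auto
    moreover have "q \<in> G (V, W)"
      using q V W unfolding Q_def G_def by auto
    ultimately show "q \<in> (\<Union>p\<in>I. G p)" by blast
  qed
  moreover have "finite (G p) \<and> card (G p) \<le> card B ^ (card Y - \<alpha> - \<beta>)" if "p \<in> I" for p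
  proof -
    obtain V W where p: "p = (V, W)" by force
    then have VW: "V \<subseteq> Y" "card V = \<alpha>" "W \<subseteq> Y - V" "card W = \<beta>"
      using that unfolding I_def by auto
    have "inj_on (\<lambda>q. restrict q (Y - V - W)) (G p)"
    proof (rule inj_onI)
      fix q q' assume q: "q \<in> G p" "q' \<in> G p"
        and eq: "restrict q (Y - V - W) = restrict q' (Y - V - W)"
      show "q = q'"
      proof
        fix i
        have "q i = q' i" if "i \<in> Y - V - W"
          using fun_cong[OF eq, of i] that by simp
        moreover have "q i = q' i" if "i \<notin> Y"
          using q p that PiE_arb[of q Y "\<lambda>_. B" i] PiE_arb[of q' Y "\<lambda>_. B" i]
          by (simp add: G_def)
        moreover have "q i = q' i" if "i \<in> V \<or> i \<in> W"
          using q p that by (auto simp: G_def)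
        ultimately show "q i = q' i" by blast
      qed
    qed
    moreover have "(\<lambda>q. restrict q (Y - V - W)) ` G p \<subseteq> (Y - V - W) \<rightarrow>\<^sub>E B"
      using p by (auto simp: G_def)
    moreover have "finite ((Y - V - W) \<rightarrow>\<^sub>E B)"
      using assms(1,2) by (simp add: finite_PiE)
    ultimately have "card (G p) \<le> card ((Y - V - W) \<rightarrow>\<^sub>E B)" "finite (G p)"
      by (auto intro: card_inj_on_le inj_on_finite)
    moreover have "card (Y - V - W) = card Y - \<alpha> - \<beta>"
      using VW assms(1) by (metis card_Diff_subset finite_Diff finite_subset)
    ultimately show ?thesis
      using assms(1) by (simp add: card_PiE)
  qed
  ultimately have sub: "Q \<subseteq> (\<Union>p\<in>I. G p)"
    and G: "\<And>p. p \<in> I \<Longrightarrow> finite (G p) \<and> card (G p) \<le> card B ^ (card Y - \<alpha> - \<beta>)"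
    by blast+
  have "card Q \<le> card (\<Union>p\<in>I. G p)"
    using G finI sub by (intro card_mono) auto
  also have "\<dots> \<le> (\<Sum>p\<in>I. card (G p))"
    by (rule card_UN_le[OF finI])
  also have "\<dots> \<le> (\<Sum>p\<in>I. card B ^ (card Y - \<alpha> - \<beta>))"
    by (rule sum_mono) (use G in blast)
  finally show ?thesis
    using finQ cardI by simp
qed

section \<open>Inequalities between binomial coefficients\<close>

lemma choose_double_le:
  assumes "2 * j \<le> Suc m"
  shows "Suc m choose j \<le> 2 * (m choose j)"
proof (cases j)
  case (Suc i)
  have "Suc i * (m choose i) \<le> (m - i) * (m choose i)"
    using assms Suc by (intro mult_le_mono) auto
  also have "\<dots> = Suc i * (m choose j)"
    using Suc by (simp only: binomial_absorb_comp binomial_absorption)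
  finally have "m choose i \<le> m choose j"
    by (simp only: Suc_mult_le_cancel1)
  then show ?thesis
    using Suc by simp
qed simp

lemma choose_le_power2_choose:
  assumes "2 * j + v \<le> d"
  shows "d choose j \<le> 2 ^ v * ((d - v) choose j)"
  using assms
proof (induction v)
  case (Suc v)
  have "d - v = Suc (d - Suc v)" using Suc.prems by simp
  then have "(d - v) choose j \<le> 2 * ((d - Suc v) choose j)"
    using choose_double_le[of j "d - Suc v"] Suc.prems by simp
  moreover have "d choose j \<le> 2 ^ v * ((d - v) choose j)"
    using Suc by simp
  ultimately have "d choose j \<le> 2 ^ v * (2 * ((d - Suc v) choose j))"
    by (meson mult_le_mono2 order_trans)
  then show ?case by (simp add: mult.assoc mult.left_commute)
qed simp

text \<open>At the cost of 2^v, \<open>d choose (r - v)\<close> becomes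
  \<open>(d - v) choose (r - v)\<close>. Picking v elements and then r - v others amounts to picking
  r elements and marking v of them.\<close>

lemma choose_mult_choose_le:
  assumes "v \<le> r" and "2 * r \<le> d"
  shows "(d choose (r - v)) * (d choose v) \<le> 2 ^ v * (r choose v) * (d choose r)"
proof -
  have "(d choose (r - v)) * (d choose v) \<le> 2 ^ v * ((d - v) choose (r - v)) * (d choose v)"
    using assms by (intro mult_le_mono1 choose_le_power2_choose) auto
  also have "\<dots> = 2 ^ v * ((d choose v) * ((d - v) choose (r - v)))"
    by simp
  also have "(d choose v) * ((d - v) choose (r - v)) = (d choose r) * (r choose v)"
    using assms by (subst choose_mult) auto
  finally show ?thesis
    by (simp only: mult_ac)
qed

text \<open>From k to k + 1 the left side gains the factor 2(y - k)/(k + 1), the right side (d -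
  k)/(k + 1), and 2(y - k) <= d - k.\<close>

lemma power2_mult_choose_le:
  assumes "2 * y \<le> d"
  shows "2 ^ k * (y choose k) \<le> d choose k"
proof (induction k)
  case (Suc k)
  have "Suc k * (2 ^ Suc k * (y choose Suc k)) = 2 * 2 ^ k * (Suc k * (y choose Suc k))"
    by (simp only: power_Suc mult_ac)
  also have "\<dots> = 2 * (y - k) * (2 ^ k * (y choose k))"
    by (simp only: binomial_absorb_comp[symmetric] binomial_absorption) (simp add: mult_ac)
  also have "\<dots> \<le> (d - k) * (d choose k)"
    using assms by (intro mult_le_mono Suc.IH) auto
  also have "\<dots> = Suc k * (d choose Suc k)"
    by (simp only: binomial_absorb_comp binomial_absorption)
  finally show ?case
    by (simp only: Suc_mult_le_cancel1)
qed simp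

section \<open>Weighted sums of binomial coefficients\<close>

lemma choose_mult_power_le:
  fixes s :: real
  assumes "0 \<le> s"
  shows "real (m choose v) * s ^ v \<le> (1 + s) ^ m"
proof (cases "v \<le> m")
  case True
  have "real (m choose v) * s ^ v \<le> (\<Sum>k\<le>m. real (m choose k) * s ^ k)"
    using True assms by (intro member_le_sum) auto
  also have "\<dots> = (s + 1) ^ m"
    by (simp add: binomial_ring)
  finally show ?thesis by (simp add: add.commute)
next
  case False
  then show ?thesis using assms by (simp add: binomial_eq_0)
qed

text \<open>The sum is the constant term of (1 + s x + s/x)^r, hence at most the value at x =
  1.\<close>

lemma central_trinomial_le:
  fixes s :: real
  assumes "0 \<le> s"
  shows "(\<Sum>v\<le>r. real (r choose v) * real ((r - v) choose v) * s ^ (2 * v)) \<le> (1 + 2 * s) ^ r"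
proof -
  have "(\<Sum>v\<le>r. real (r choose v) * real ((r - v) choose v) * s ^ (2 * v))
      = (\<Sum>v\<le>r. real (r choose v) * s ^ v * (real ((r - v) choose v) * s ^ v))"
    by (simp add: mult_2 power_add mult.assoc mult.left_commute)
  also have "\<dots> \<le> (\<Sum>v\<le>r. real (r choose v) * s ^ v * (1 + s) ^ (r - v))"
    using assms by (intro sum_mono mult_left_mono choose_mult_power_le) auto
  also have "\<dots> = (s + (1 + s)) ^ r"
    by (subst binomial_ring) simp
  finally show ?thesis by (simp add: algebra_simps)
qed

text \<open>Closes the induction over hidden differences: y coordinates are revealed, v of the r
  differences stay hidden, and the last factor of each term is the inductive bound for v.\<close>

lemma branching_sum_le:
  fixes n d r y :: nat
  assumes n: "2 \<le> n" and y: "2 * y \<le> d" and r: "2 * r \<le> d"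
  shows "(\<Sum>v | 2 * v \<le> r \<and> r - v \<le> y. (y choose v) * ((y - v) choose (y - (r - v)))
            * n ^ (y - v - (y - (r - v))) * ((d choose v) * (3 * n) ^ v))
         \<le> (d choose r) * (3 * n) ^ r"
    (is "(\<Sum>v | _ v. ?f v) \<le> _")
proof -
  let ?V = "{v. 2 * v \<le> r \<and> r - v \<le> y}"
  have bound: "2 ^ r * ?f v \<le> (d choose r) * n ^ r * ((r choose v) * ((r - v) choose v) * 6 ^ v)"
    if "v \<in> ?V" for v
  proof -
    have v: "v \<le> r" "2 * v \<le> r" "r - v \<le> y" using that by auto
    \<comment> \<open>Instead of the places agreeing with \<open>c\<close> and then those agreeing
      with \<open>z\<close>, choose the r - v places differing from \<open>z\<close>, then v among
      them. The factor 2^(r - v) can then be absorbed because y <= d/2.\<close>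
    have "(y choose v) * ((y - v) choose (y - (r - v))) = (y choose v) * ((y - v) choose (r - v - v))"
      using v by (subst binomial_symmetric) auto
    also have "\<dots> = (y choose (r - v)) * ((r - v) choose v)"
      using v by (subst choose_mult) auto
    finally have "2 ^ r * ?f v
        = 2 ^ v * (2 ^ (r - v) * (y choose (r - v))) * ((r - v) choose v) * n ^ (r - 2 * v) * ((d choose v) * (3 * n) ^ v)"
      using v by (simp add: mult_2 power_add[symmetric])
    also have "\<dots> \<le> 2 ^ v * (d choose (r - v)) * ((r - v) choose v) * n ^ (r - 2 * v) * ((d choose v) * (3 * n) ^ v)"
      by (intro mult_le_mono order_refl power2_mult_choose_le y)
    also have "\<dots> = 2 ^ v * ((r - v) choose v) * n ^ (r - 2 * v) * (3 * n) ^ v * ((d choose (r - v)) * (d choose v))"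
      by (simp add: mult_ac)
    also have "\<dots> \<le> 2 ^ v * ((r - v) choose v) * n ^ (r - 2 * v) * (3 * n) ^ v * (2 ^ v * (r choose v) * (d choose r))"
      by (intro mult_le_mono order_refl choose_mult_choose_le v r)
    also have "\<dots> = (d choose r) * ((r choose v) * ((r - v) choose v)) * (6 ^ v * (2 ^ v * n ^ (r - v)))"
    proof -
      have "n ^ (r - v) = n ^ (r - 2 * v) * n ^ v"
        using v by (simp add: power_add[symmetric])
      moreover have "(6::nat) ^ v = 2 ^ v * 3 ^ v"
        by (simp add: power_mult_distrib[symmetric])
      ultimately show ?thesis by (simp add: power_mult_distrib mult_ac)
    qed
    \<comment> \<open>This is where n >= 2 enters: 2^v <= n^v supplies the missing power of
      n.\<close>
    also have "\<dots> \<le> (d choose r) * ((r choose v) * ((r - v) choose v)) * (6 ^ v * (n ^ v * n ^ (r - v)))"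
      using n by (intro mult_le_mono order_refl power_mono) auto
    also have "n ^ v * n ^ (r - v) = n ^ r"
      using v by (simp add: power_add[symmetric])
    finally show ?thesis by (simp add: mult_ac)
  qed
  have "2 ^ r * sum ?f ?V \<le> (\<Sum>v\<in>?V. (d choose r) * n ^ r * ((r choose v) * ((r - v) choose v) * 6 ^ v))"
    unfolding sum_distrib_left by (rule sum_mono) (rule bound)
  also have "\<dots> \<le> (\<Sum>v\<le>r. (d choose r) * n ^ r * ((r choose v) * ((r - v) choose v) * 6 ^ v))"
    by (rule sum_mono2) auto
  also have "\<dots> = (d choose r) * n ^ r * (\<Sum>v\<le>r. (r choose v) * ((r - v) choose v) * 6 ^ v)"
    by (simp only: sum_distrib_left)
  also have "\<dots> \<le> (d choose r) * n ^ r * 6 ^ r"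
  proof -
    \<comment> \<open>\<open>6 \<le> (5/2)\<^sup>2\<close> and \<open>1 + 2 \<cdot> 5/2 = 2 \<cdot> 3\<close>: this is what the constant 3 in \<open>(3n)\<^sup>r\<close> is chosen for.\<close>
    have "real (\<Sum>v\<le>r. (r choose v) * ((r - v) choose v) * 6 ^ v)
        \<le> (\<Sum>v\<le>r. real (r choose v) * real ((r - v) choose v) * (5 / 2) ^ (2 * v))"
      by (simp, intro sum_mono mult_left_mono) (auto simp: power_mult power2_eq_square intro: power_mono)
    also have "\<dots> \<le> (1 + 2 * (5 / 2)) ^ r"
      by (rule central_trinomial_le) simp
    also have "\<dots> = real (6 ^ r)" by simp
    finally show ?thesis by (simp only: of_nat_le_iff) simp
  qed
  also have "\<dots> = 2 ^ r * ((d choose r) * (3 * n) ^ r)"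
    by (simp add: power_mult_distrib mult_ac flip: power_mult_distrib[of 2 3])
  finally show ?thesis by simp
qed

text \<open>After 3^v is replaced by (n t^3)^v, a factor t^v joins one \<open>d choose v\<close> and
  the product is at most (1 + t)^d for every v; the remaining t^(2v) completes a central trinomial
  sum.\<close>

lemma first_step_sum_le:
  fixes n d :: nat
  assumes n: "2 \<le> n"
  shows "real (\<Sum>v | 2 * v \<le> d. (d choose v) * ((d - v) choose v) * n ^ (d - v - v) * ((d choose v) * (3 * n) ^ v))
         \<le> (real n + 8 * real n powr (2 / 3)) ^ d"
    (is "real (sum ?f ?V) \<le> _")
proof -
  define m where "m = real n powr (- (1 / 3))"
  \<comment> \<open>The factor must have cube at least 3, and \<open>3t + 2t\<^sup>2 \<le> 8m\<close> must hold down to \<open>n = 2\<close>.\<close>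
  define t where "t = 29 / 20 * m"
  have m0: "0 < m" using n by (simp add: m_def)
  then have t0: "0 \<le> t" by (simp add: t_def)
  have m3: "m ^ 3 = 1 / real n"
  proof -
    have "m ^ 3 = m powr 3" using m0 by simp
    also have "\<dots> = real n powr (- 1)" unfolding m_def powr_powr by simp
    finally show ?thesis using n by (simp add: powr_minus_divide)
  qed
  have nm: "real n * m = real n powr (2 / 3)"
    using powr_mult_base[of "real n" "- (1 / 3)"] by (simp add: m_def)
  \<comment> \<open>4/5 is a rational just above 2^(-1/3), the value of \<open>m\<close> at n = 2.
    It makes the final coefficient 87/20 + 841/250 = 7.714 < 8.\<close>
  have m1: "m \<le> 4 / 5"
  proof (rule ccontr)
    assume "\<not> m \<le> 4 / 5"
    then have "(4 / 5) ^ 3 \<le> m ^ 3" by (intro power_mono) auto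
    moreover have "1 / real n \<le> 1 / 2" using n by (simp add: field_simps)
    ultimately show False using m3 by (simp add: power3_eq_cube)
  qed
  have t3: "3 \<le> real n * t ^ 3"
    using n m3 by (simp add: t_def power_mult_distrib power_divide)
  have bound: "real (?f v) \<le> real n ^ d * (1 + t) ^ d * (real (d choose v) * real ((d - v) choose v) * t ^ (2 * v))"
    if "v \<in> ?V" for v
  proof -
    have "real (?f v) = real (d choose v) * real ((d - v) choose v) * real n ^ (d - v - v) * real n ^ v * 3 ^ v * real (d choose v)"
      by (simp add: power_mult_distrib mult_ac)
    also have "\<dots> \<le> real (d choose v) * real ((d - v) choose v) * real n ^ (d - v - v) * real n ^ v * (real n * t ^ 3) ^ v * real (d choose v)"
      using t3 by (intro mult_right_mono mult_left_mono power_mono) auto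
    also have "\<dots> = real (d choose v) * real ((d - v) choose v) * (real n ^ (d - v - v) * real n ^ v * real n ^ v) * t ^ (2 * v) * (real (d choose v) * t ^ v)"
    proof -
      have "(real n * t ^ 3) ^ v = real n ^ v * (t ^ (2 * v) * t ^ v)"
        by (simp add: power_mult_distrib flip: power_mult power_add)
      then show ?thesis by (simp add: mult_ac)
    qed
    also have "real n ^ (d - v - v) * real n ^ v * real n ^ v = real n ^ d"
      using that by (simp add: mult_2 flip: power_add)
    also have "real (d choose v) * real ((d - v) choose v) * real n ^ d * t ^ (2 * v) * (real (d choose v) * t ^ v)
       \<le> real (d choose v) * real ((d - v) choose v) * real n ^ d * t ^ (2 * v) * (1 + t) ^ d"
      using t0 by (intro mult_left_mono choose_mult_power_le) auto
    finally show ?thesis by (simp add: mult_ac)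
  qed
  have "real (sum ?f ?V) \<le> (\<Sum>v\<in>?V. real n ^ d * (1 + t) ^ d * (real (d choose v) * real ((d - v) choose v) * t ^ (2 * v)))"
    unfolding of_nat_sum by (rule sum_mono) (rule bound)
  also have "\<dots> \<le> (\<Sum>v\<le>d. real n ^ d * (1 + t) ^ d * (real (d choose v) * real ((d - v) choose v) * t ^ (2 * v)))"
    using t0 by (intro sum_mono2) auto
  also have "\<dots> = real n ^ d * (1 + t) ^ d * (\<Sum>v\<le>d. real (d choose v) * real ((d - v) choose v) * t ^ (2 * v))"
    by (simp only: sum_distrib_left)
  also have "\<dots> \<le> real n ^ d * (1 + t) ^ d * (1 + 2 * t) ^ d"
    using t0 by (intro mult_left_mono central_trinomial_le) auto
  also have "\<dots> = (real n * ((1 + t) * (1 + 2 * t))) ^ d"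
    by (simp add: power_mult_distrib)
  also have "\<dots> \<le> (real n + 8 * real n powr (2 / 3)) ^ d"
  proof (rule power_mono)
    have "m * m \<le> m * (4 / 5)" using m0 m1 by (intro mult_left_mono) auto
    moreover have "(1 + t) * (1 + 2 * t) = 1 + 87 / 20 * m + 841 / 200 * (m * m)"
      by (simp add: t_def field_simps)
    ultimately have "(1 + t) * (1 + 2 * t) \<le> 1 + 8 * m"
      using m0 by linarith
    then have "real n * ((1 + t) * (1 + 2 * t)) \<le> real n * (1 + 8 * m)"
      by (intro mult_left_mono) auto
    then show "real n * ((1 + t) * (1 + 2 * t)) \<le> real n + 8 * real n powr (2 / 3)"
      using nm by (simp add: algebra_simps)
  qed (use t0 in auto)
  finally show ?thesis .
qed

section \<open>The counting argument by successive revelation\<close>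

definition differ :: "(nat \<Rightarrow> nat) \<Rightarrow> (nat \<Rightarrow> nat) \<Rightarrow> nat set" where
  "differ a b = {i. a i \<noteq> b i}"

text \<open>\<open>far_point\<close> merges maximality and the absence of 1-balls, so that it
  applies to any guess, in \<open>S\<close> or not. Infinite distance is a separate case because
  \<open>card\<close> is 0 on infinite sets.\<close>

locale spread_family =
  fixes n d :: nat and S :: "(nat \<Rightarrow> nat) set" and z w :: "nat \<Rightarrow> nat"
  assumes n_ge: "2 \<le> n"
    and subset_seqs: "S \<subseteq> seqs n"
    and finite_differ: "\<And>a b. a \<in> S \<Longrightarrow> b \<in> S \<Longrightarrow> finite (differ a b)"
    and card_differ: "\<And>a b. a \<in> S \<Longrightarrow> b \<in> S \<Longrightarrow> card (differ a b) \<le> d"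
    and far_point: "\<And>b. b \<in> seqs n \<Longrightarrow> \<exists>c\<in>S. infinite (differ b c) \<or> d \<le> card (differ b c)"
    and z_in: "z \<in> S" and w_in: "w \<in> S" and zw: "card (differ z w) = d"
begin

text \<open>Off \<open>differ z w\<close> the point \<open>c\<close> has the same differences from
  \<open>z\<close> and from \<open>w\<close>; on it, every place is a difference from at least one
  of them. The two distances thus add up to at least d plus twice the outside part, and to at most
  2d.\<close>

lemma card_differ_outside_le:
  assumes c: "c \<in> S" and X: "differ z w \<subseteq> X"
  shows "2 * card (differ z c - X) \<le> d"
proof -
  let ?U = "differ z w"
  have fin: "finite (differ z c)" "finite (differ w c)" "finite ?U"
    using finite_differ z_in w_in c by auto
  have "card (differ z c) = card (differ z c \<inter> ?U) + card (differ z c - ?U)"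
    using fin card_Un_disjoint[of "differ z c \<inter> ?U" "differ z c - ?U"]
    by (simp add: Int_Diff_Un Int_Diff_disjoint)
  moreover have "card (differ w c) = card (differ w c \<inter> ?U) + card (differ w c - ?U)"
    using fin card_Un_disjoint[of "differ w c \<inter> ?U" "differ w c - ?U"]
    by (simp add: Int_Diff_Un Int_Diff_disjoint)
  moreover have "differ w c - ?U = differ z c - ?U"
    by (auto simp: differ_def)
  then have "card (differ w c - ?U) = card (differ z c - ?U)" by simp
  moreover have "card ?U \<le> card (differ z c \<inter> ?U) + card (differ w c \<inter> ?U)"
    using fin by (intro order_trans[OF card_mono card_Un_le]) (auto simp: differ_def)
  moreover have "card (differ z c - X) \<le> card (differ z c - ?U)"
    using fin X by (intro card_mono) auto
  ultimately show ?thesis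
    using card_differ[OF z_in c] card_differ[OF w_in c] zw by linarith
qed

text \<open>\<open>X\<close> holds the revealed coordinates, \<open>p\<close> their values (only
  those on \<open>X\<close> matter), and \<open>r\<close> counts the hidden differences from
  \<open>z\<close>.\<close>

definition cluster :: "nat set \<Rightarrow> (nat \<Rightarrow> nat) \<Rightarrow> nat \<Rightarrow> (nat \<Rightarrow> nat) set" where
  "cluster X p r = {a \<in> S. (\<forall>i\<in>X. a i = p i) \<and> card (differ z a - X) = r}"

lemma card_cluster_le:
  assumes "finite X" and "differ z w \<subseteq> X"
  shows "finite (cluster X p r) \<and> card (cluster X p r) \<le> (d choose r) * (3 * n) ^ r"
  using assms
proof (induction r arbitrary: X p rule: less_induct)
  case (less r)
  note X = less.prems
  show ?case
  \<comment> \<open>The empty cluster is set aside because a member \<open>a0\<close> is what shows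
    that 2r <= d and that \<open>p\<close> takes legal values on \<open>X\<close>, so that the guess
    \<open>a'\<close> lies in \<open>seqs n\<close>.\<close>
  proof (cases "r = 0 \<or> cluster X p r = {}")
    case True
    have "a i = (if i \<in> X then p i else z i)" if "a \<in> cluster X p 0" for a i
      using that finite_differ[OF z_in, of a]
      by (cases "z i = a i") (auto simp: cluster_def differ_def)
    then have "cluster X p 0 \<subseteq> {\<lambda>i. if i \<in> X then p i else z i}"
      by blast
    then have "finite (cluster X p 0) \<and> card (cluster X p 0) \<le> 1"
      using finite_subset card_mono[of "{\<lambda>i. if i \<in> X then p i else z i}"] by fastforce
    then show ?thesis using True by auto
  next
    case False
    then obtain a0 where a0: "a0 \<in> cluster X p r" and r: "r \<noteq> 0" by auto
    then have r2: "2 * r \<le> d"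
      using card_differ_outside_le[of a0 X] X by (auto simp: cluster_def)
    define a' where "a' = (\<lambda>i. if i \<in> X then p i else z i)"
    have "a' i = (if i \<in> X then a0 i else z i)" for i
      using a0 by (auto simp: a'_def cluster_def)
    moreover have "a0 \<in> seqs n" "z \<in> seqs n"
      using a0 z_in subset_seqs by (auto simp: cluster_def)
    ultimately have "a' \<in> seqs n"
      by (simp add: seqs_def Pi_iff)
    then obtain c where c: "c \<in> S" and far: "infinite (differ a' c) \<or> d \<le> card (differ a' c)"
      using far_point by blast
    define Y where "Y = differ z c - X"
    have finY: "finite Y" using finite_differ z_in c by (simp add: Y_def)
    have y2: "2 * card Y \<le> d"
      unfolding Y_def using card_differ_outside_le c X by blast
    have split': "differ a' c = (differ a' c \<inter> X) \<union> Y"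
      by (auto simp: differ_def Y_def a'_def)
    then have "finite (differ a' c)"
      using X finY by (metis finite_Int finite_Un)
    moreover have "card (differ a' c) \<le> card (differ a' c \<inter> X) + card Y"
      by (subst split') (rule card_Un_le)
    ultimately have far': "d \<le> card (differ a' c \<inter> X) + card Y"
      using far by auto
    define A where "A v = {a \<in> cluster X p r. card (differ z a - (X \<union> Y)) = v}" for v
    define Q where "Q v = {q \<in> Y \<rightarrow>\<^sub>E {1..n}. v \<le> card {i \<in> Y. q i = c i}
        \<and> card Y - (r - v) \<le> card {i \<in> Y. q i = z i}}" for v
    define V where "V = {v. 2 * v \<le> r \<and> r - v \<le> card Y}"
    have finV: "finite V" unfolding V_def by (rule finite_subset[of _ "{..r}"]) auto
    have reveal: "v \<in> V \<and> restrict a Y \<in> Q v" if "a \<in> A v" for a v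
    proof -
      have a: "a \<in> S" "\<And>i. i \<in> X \<Longrightarrow> a i = p i" "card (differ z a - X) = r"
        and v: "card (differ z a - (X \<union> Y)) = v"
        using that by (auto simp: A_def cluster_def)
      have fin: "finite (differ z a)" "finite (differ a c)"
        using finite_differ a(1) z_in c by auto
      define k where "k = card (differ z a \<inter> Y)"
      define u where "u = card {i \<in> Y. a i = c i}"
      have "differ z a - X = (differ z a \<inter> Y) \<union> (differ z a - (X \<union> Y))"
        by (auto simp: Y_def)
      then have "card (differ z a - X) = card (differ z a \<inter> Y) + card (differ z a - (X \<union> Y))"
        using fin by (simp add: card_Un_disjoint Int_Diff_disjoint disjoint_iff)
      then have kv: "r = k + v" using a v by (simp add: k_def)
      \<comment> \<open>On \<open>Y\<close> the points \<open>c\<close> and \<open>z\<close> differ,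
        so an agreement with \<open>c\<close> is a difference from \<open>z\<close>.\<close>
      have uk: "u \<le> k" unfolding u_def k_def
        using fin by (intro card_mono) (auto simp: differ_def Y_def)
      have "Y = {i \<in> Y. a i = c i} \<union> {i \<in> Y. a i \<noteq> c i}" by auto
      then have yu: "card Y = u + card {i \<in> Y. a i \<noteq> c i}"
        unfolding u_def using finY by (subst card_Un_disjoint[symmetric]) auto
      have "Y = (differ z a \<inter> Y) \<union> {i \<in> Y. a i = z i}" by (auto simp: differ_def)
      then have yk: "card Y = k + card {i \<in> Y. a i = z i}"
        unfolding k_def using finY by (subst card_Un_disjoint[symmetric]) (auto simp: differ_def)
      \<comment> \<open>Compare \<open>a\<close> and \<open>a'\<close> as seen from
        \<open>c\<close>: equal contribution on \<open>X\<close>, a loss of u on \<open>Y\<close>, a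
        gain of v elsewhere. As \<open>a'\<close> is at distance at least d and \<open>a\<close> at
        most d, v <= u; with u <= k = r - v this gives 2v <= r.\<close>
      have "differ a c = (differ a' c \<inter> X) \<union> ({i \<in> Y. a i \<noteq> c i} \<union> (differ z a - (X \<union> Y)))"
        using a(2) by (auto simp: differ_def a'_def Y_def)
      also have "card \<dots> = card (differ a' c \<inter> X) + card ({i \<in> Y. a i \<noteq> c i} \<union> (differ z a - (X \<union> Y)))"
        using X finY fin by (intro card_Un_disjoint) (auto simp: Y_def)
      also have "card ({i \<in> Y. a i \<noteq> c i} \<union> (differ z a - (X \<union> Y))) = card {i \<in> Y. a i \<noteq> c i} + v"
        unfolding v[symmetric] using finY fin by (intro card_Un_disjoint) auto
      finally have "v \<le> u"
        using card_differ[OF a(1) c] far' yu by linarith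
      then have "v \<in> V" using kv uk yk by (simp add: V_def)
      moreover have "restrict a Y \<in> Y \<rightarrow>\<^sub>E {1..n}"
        using a(1) subset_seqs by (auto simp: seqs_def)
      moreover have "{i \<in> Y. restrict a Y i = c i} = {i \<in> Y. a i = c i}"
        "{i \<in> Y. restrict a Y i = z i} = {i \<in> Y. a i = z i}" by auto
      ultimately show ?thesis
        using \<open>v \<le> u\<close> yk kv by (simp add: Q_def u_def)
    qed
    have A: "finite (A v) \<and> card (A v) \<le> (card Y choose v) * ((card Y - v) choose (card Y - (r - v)))
        * n ^ (card Y - v - (card Y - (r - v))) * ((d choose v) * (3 * n) ^ v)" if v: "v \<in> V" for v
    proof -
      have Q: "finite (Q v) \<and> card (Q v) \<le> (card Y choose v) * ((card Y - v) choose (card Y - (r - v)))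
          * card {1..n} ^ (card Y - v - (card Y - (r - v)))"
        unfolding Q_def by (rule card_agreeing_functions[OF finY]) (auto simp: Y_def differ_def)
      have "finite (A v) \<and> card (A v) \<le> card (Q v) * ((d choose v) * (3 * n) ^ v)"
      proof (rule finite_card_le_fibres[where f = "\<lambda>a. restrict a Y"])
        fix q
        have "{a \<in> A v. restrict a Y = q} \<subseteq> cluster (X \<union> Y) (\<lambda>i. if i \<in> X then p i else q i) v"
          by (auto simp: A_def cluster_def)
        \<comment> \<open>The induction hypothesis applies: 2v <= r and r nonzero give v <
          r.\<close>
        moreover have "finite (cluster (X \<union> Y) (\<lambda>i. if i \<in> X then p i else q i) v)
            \<and> card (cluster (X \<union> Y) (\<lambda>i. if i \<in> X then p i else q i) v) \<le> (d choose v) * (3 * n) ^ v"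
          using v r X finY by (intro less.IH) (auto simp: V_def)
        ultimately show "finite {a \<in> A v. restrict a Y = q}
            \<and> card {a \<in> A v. restrict a Y = q} \<le> (d choose v) * (3 * n) ^ v"
          by (meson card_mono finite_subset order_trans)
      qed (use Q reveal in auto)
      then show ?thesis
        using Q by (metis (no_types, lifting) card_atLeastAtMost diff_Suc_1 mult_le_mono1 order_trans)
    qed
    have eq: "cluster X p r = (\<Union>v\<in>V. A v)"
      using reveal by (auto simp: A_def)
    have "card (\<Union>v\<in>V. A v) \<le> (\<Sum>v\<in>V. card (A v))"
      by (rule card_UN_le[OF finV])
    also have "\<dots> \<le> (\<Sum>v\<in>V. (card Y choose v) * ((card Y - v) choose (card Y - (r - v)))
        * n ^ (card Y - v - (card Y - (r - v))) * ((d choose v) * (3 * n) ^ v))"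
      by (rule sum_mono) (use A in blast)
    also have "\<dots> \<le> (d choose r) * (3 * n) ^ r"
      unfolding V_def by (rule branching_sum_le[OF n_ge y2 r2])
    finally show ?thesis
      using A finV eq by auto
  qed
qed

text \<open>The first revelation uses \<open>differ z w\<close> itself, with \<open>w\<close> in the
  role of \<open>c\<close>; \<open>card_cluster_le\<close> then bounds each fibre.\<close>

lemma card_le:
  "finite S \<and> real (card S) \<le> (real n + 8 * real n powr (2 / 3)) ^ d"
proof -
  define X where "X = differ z w"
  have finX: "finite X" and cardX: "card X = d"
    using finite_differ z_in w_in zw by (auto simp: X_def)
  define A where "A v = {a \<in> S. card (differ z a - X) = v}" for v
  define Q where "Q v = {q \<in> X \<rightarrow>\<^sub>E {1..n}. v \<le> card {i \<in> X. q i = w i}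
      \<and> v \<le> card {i \<in> X. q i = z i}}" for v
  define V where "V = {v. 2 * v \<le> d}"
  have finV: "finite V" unfolding V_def by (rule finite_subset[of _ "{..d}"]) auto
  \<comment> \<open>As \<open>X\<close> has exactly d elements and the distance is at most d, each
    difference outside \<open>X\<close> is paid for by an agreement inside.\<close>
  have agree: "card (differ b a - X) \<le> card {i \<in> X. a i = b i}" if "a \<in> S" "b \<in> S" for a b
  proof -
    have fin: "finite (differ b a)" using finite_differ that by auto
    have "differ b a = (differ b a \<inter> X) \<union> (differ b a - X)" by auto
    then have "card (differ b a) = card (differ b a \<inter> X) + card (differ b a - X)"
      using fin by (metis Int_Diff_disjoint card_Un_disjoint finite_Diff finite_Int)
    moreover have "X = (differ b a \<inter> X) \<union> {i \<in> X. a i = b i}" by (auto simp: differ_def)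
    then have "card X = card (differ b a \<inter> X) + card {i \<in> X. a i = b i}"
      using finX by (subst card_Un_disjoint[symmetric]) (auto simp: differ_def)
    ultimately show ?thesis using card_differ[of b a] that cardX by linarith
  qed
  have reveal: "restrict a X \<in> Q v" if "a \<in> A v" for a v
  proof -
    have a: "a \<in> S" "card (differ z a - X) = v"
      using that by (auto simp: A_def)
    have "differ w a - X = differ z a - X" by (auto simp: X_def differ_def)
    then have "v \<le> card {i \<in> X. a i = w i}" "v \<le> card {i \<in> X. a i = z i}"
      using agree[OF a(1) w_in] agree[OF a(1) z_in] a(2) by auto
    moreover have "restrict a X \<in> X \<rightarrow>\<^sub>E {1..n}"
      using a(1) subset_seqs by (auto simp: seqs_def)
    moreover have "{i \<in> X. restrict a X i = w i} = {i \<in> X. a i = w i}"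
      "{i \<in> X. restrict a X i = z i} = {i \<in> X. a i = z i}" by auto
    ultimately show ?thesis by (simp add: Q_def)
  qed
  have A: "finite (A v) \<and> card (A v) \<le> (d choose v) * ((d - v) choose v)
        * n ^ (d - v - v) * ((d choose v) * (3 * n) ^ v)" for v
  proof -
    have Q: "finite (Q v) \<and> card (Q v) \<le> (card X choose v) * ((card X - v) choose v)
          * card {1..n} ^ (card X - v - v)"
      unfolding Q_def by (rule card_agreeing_functions) (auto simp: finX, auto simp: X_def differ_def)
    have "finite (A v) \<and> card (A v) \<le> card (Q v) * ((d choose v) * (3 * n) ^ v)"
    proof (rule finite_card_le_fibres[where f = "\<lambda>a. restrict a X"])
      fix q
      have "{a \<in> A v. restrict a X = q} \<subseteq> cluster X q v"
        by (auto simp: A_def cluster_def)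
      moreover have "finite (cluster X q v) \<and> card (cluster X q v) \<le> (d choose v) * (3 * n) ^ v"
        using finX by (intro card_cluster_le) (auto simp: X_def)
      ultimately show "finite {a \<in> A v. restrict a X = q}
            \<and> card {a \<in> A v. restrict a X = q} \<le> (d choose v) * (3 * n) ^ v"
        by (meson card_mono finite_subset order_trans)
    qed (use Q reveal in auto)
    then show ?thesis
      using Q cardX by (metis (no_types, lifting) card_atLeastAtMost diff_Suc_1 mult_le_mono1 order_trans)
  qed
  have S: "S = (\<Union>v\<in>V. A v)"
    using card_differ_outside_le by (auto simp: A_def V_def X_def)
  have "card (\<Union>v\<in>V. A v) \<le> (\<Sum>v\<in>V. card (A v))"
    by (rule card_UN_le[OF finV])
  also have "\<dots> \<le> (\<Sum>v\<in>V. (d choose v) * ((d - v) choose v) * n ^ (d - v - v) * ((d choose v) * (3 * n) ^ v))"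
    by (rule sum_mono) (use A in blast)
  finally have "real (card S) \<le> real (\<Sum>v\<in>V. (d choose v) * ((d - v) choose v) * n ^ (d - v - v) * ((d choose v) * (3 * n) ^ v))"
    unfolding S[symmetric] by (rule of_nat_mono)
  also have "\<dots> \<le> (real n + 8 * real n powr (2 / 3)) ^ d"
    unfolding V_def by (rule first_step_sum_le[OF n_ge])
  finally show ?thesis
    using A finV S finite_UN_I[of V A] by simp
qed

end

section \<open>From maximality and the absence of 1-balls to far points\<close>

lemma hamming_dist_le_iff:
  "hamming_dist a b \<le> enat k \<longleftrightarrow> finite (differ a b) \<and> card (differ a b) \<le> k"
  by (auto simp: hamming_dist_def differ_def)

lemma hamming_diam_le_iff:
  "hamming_diam S \<le> enat k \<longleftrightarrow> (\<forall>a\<in>S. \<forall>b\<in>S. finite (differ a b) \<and> card (differ a b) \<le> k)"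
  by (simp add: hamming_diam_def SUP_le_iff hamming_dist_le_iff)

lemma diam_maximal_far_point:
  assumes max: "diam_maximal n d S" and b: "b \<in> seqs n" "b \<notin> S"
  shows "\<exists>c\<in>S. infinite (differ b c) \<or> d < card (differ b c)"
proof (rule ccontr)
  assume "\<not> ?thesis"
  then have near: "finite (differ b c) \<and> card (differ b c) \<le> d" if "c \<in> S" for c
    using that by auto
  have "differ c b = differ b c" for c by (auto simp: differ_def)
  then have "finite (differ c b) \<and> card (differ c b) \<le> d" if "c \<in> S" for c
    using near[OF that] by metis
  moreover have "differ b b = {}" by (simp add: differ_def)
  moreover have "\<forall>a\<in>S. \<forall>c\<in>S. finite (differ a c) \<and> card (differ a c) \<le> d"
    using max hamming_diam_le_iff[of S d] by (simp add: diam_maximal_def)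
  ultimately have "hamming_diam (insert b S) \<le> enat d"
    unfolding hamming_diam_le_iff using near by simp
  moreover have "hamming_diam S \<le> hamming_diam (insert b S)"
    unfolding hamming_diam_def by (intro SUP_subset_mono) auto
  ultimately have "hamming_diam (insert b S) = enat d"
    using max by (simp add: diam_maximal_def)
  then have "insert b S = S"
    using max b unfolding diam_maximal_def by blast
  then show False using b by auto
qed

text \<open>Some \<open>b\<close> outside \<open>S\<close> is within 1 of \<open>a\<close>; a point
  of \<open>S\<close> at distance more than d from \<open>b\<close> is at distance at least d from
  \<open>a\<close>.\<close>

lemma no_ball_far_point:
  assumes max: "diam_maximal n d S" and no_ball: "\<not> contains_ball n 1 S" and a: "a \<in> S"
  shows "\<exists>c\<in>S. infinite (differ a c) \<or> d \<le> card (differ a c)"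
proof -
  have "a \<in> seqs n" using max a by (auto simp: diam_maximal_def)
  then obtain b where b: "b \<in> seqs n" "b \<notin> S" "finite (differ a b)" "card (differ a b) \<le> 1"
    using no_ball unfolding contains_ball_def hamming_ball_def
    unfolding hamming_dist_le_iff by blast
  obtain c where c: "c \<in> S" "infinite (differ b c) \<or> d < card (differ b c)"
    using diam_maximal_far_point[OF max b(1,2)] by blast
  have "d \<le> card (differ a c)" if fin: "finite (differ a c)"
  proof -
    have sub: "differ b c \<subseteq> differ a b \<union> differ a c" by (auto simp: differ_def)
    then have "finite (differ b c)" using fin b(3) finite_subset by blast
    moreover have "card (differ b c) \<le> card (differ a b) + card (differ a c)"
      using sub fin b(3) by (meson card_Un_le card_mono finite_UnI order_trans)
    ultimately show ?thesis using c(2) b(4) by linarith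
  qed
  then show ?thesis using c(1) by blast
qed

theorem theorem1:
  fixes n d :: nat and S :: "(nat \<Rightarrow> nat) set"
  assumes "n \<ge> 1" and "d \<ge> 1"
    and "diam_maximal n d S"
    and "\<not> contains_ball n 1 S"
  shows "finite S \<and>
    real (card S) \<le> (real d)\<^sup>2 * (real n + 8 * real n powr (2 / 3)) ^ d"
proof -
  note max = assms(3)
  have diam: "finite (differ a b) \<and> card (differ a b) \<le> d" if "a \<in> S" "b \<in> S" for a b
    using that max hamming_diam_le_iff[of S d] by (simp add: diam_maximal_def)
  have "S \<noteq> {}"
  proof
    assume "S = {}"
    then have "hamming_diam S = 0" by (simp add: hamming_diam_def bot_enat_def)
    then show False using max assms(2) by (simp add: diam_maximal_def zero_enat_def)
  qed
  then obtain z where z: "z \<in> S" by blast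
  then obtain w where w: "w \<in> S" "card (differ z w) = d"
    using no_ball_far_point[OF max assms(4) z] diam by (metis le_antisym)
  have S: "S \<subseteq> seqs n" using max by (simp add: diam_maximal_def)
  \<comment> \<open>With one symbol there is only one sequence, whereas \<open>z\<close> and
    \<open>w\<close> are at distance d >= 1.\<close>
  have "n \<noteq> 1"
  proof
    assume n: "n = 1"
    have "z i = w i" for i
    proof -
      have "z i \<in> {1..n}" "w i \<in> {1..n}"
        using z w(1) S unfolding seqs_def by blast+
      then show ?thesis using n by simp
    qed
    then show False using w(2) assms(2) by (simp add: differ_def)
  qed
  then interpret spread_family n d S z w
  proof unfold_locales
    show "\<exists>c\<in>S. infinite (differ b c) \<or> d \<le> card (differ b c)" if "b \<in> seqs n" for b
      using diam_maximal_far_point[OF max that] no_ball_far_point[OF max assms(4)]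
      by (meson less_imp_le)
  qed (use assms(1) S diam z w in auto)
  have "1 \<le> (real d)\<^sup>2" using assms(2) by simp
  then have "(real n + 8 * real n powr (2 / 3)) ^ d \<le> (real d)\<^sup>2 * (real n + 8 * real n powr (2 / 3)) ^ d"
    using mult_right_mono[of 1 "(real d)\<^sup>2" "(real n + 8 * real n powr (2 / 3)) ^ d"] by simp
  then show ?thesis using card_le by linarith
qed

end
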